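(* Let $n$ be a power of $2$, let $A,W\in\{0,1\}^{n\times n}$, let $f$ be the function computed by $W$ and let $N(f)$ be its nondeterministic communication complexity. Let $k\ge1$ and let $k'\ge k\cdot 2^{N(f)}$. If $U\in\{0,1\}^{n\times k'}$, $V\in\{0,1\}^{k'\times n}$ satisfy $$\|A\circ W-U\cdot V\|_0\le\min_{\hat U\in\{0,1\}^{n\times k'},\hat V\in\{0,1\}^{k'\times n}}\|A\circ W-\hat U\cdot\hat V\|_0+\Delta$$ for some $\Delta\ge0$, then $$\|W\circ(A-U\cdot V)\|_0\le 2^{N(f)}\cdot OPT+\Delta,$$ where $OPT=\min_{\hat U\in\{0,1\}^{n\times k},\hat V\in\{0,1\}^{k\times n}}\|W\circ(A-\hat U\cdot\hat V)\|_0$.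
   Context: Here $U\cdot V$ denotes Boolean matrix multiplication: $(U\cdot V)_{i,j}=\bigvee_{l}(U_{i,l}\wedge V_{l,j})$. $\|M\|_0$ is the number of nonzero entries of $M$, and $\circ$ the entrywise product. Rows and columns of $W$ are indexed by $x,y\in\{0,1\}^{\log n}$ and $f(x,y)=W_{x,y}$. The nondeterministic communication complexity $N(f)$ is the minimum number such that the communication matrix $W$ can be covered by $2^{N(f)}$ possibly overlapping combinatorial rectangles $S\times T$ ($S,T\subseteq\{0,1\}^{\log n}$) such that every $(x,y)$ with $f(x,y)=1$ lies in at least one rectangle and no $(x,y)$ with $f(x,y)=0$ lies in any rectangle. *)

theory Defs
  imports "Jordan_Normal_Form.Matrix" Complex_Main
begin

(* Entries are integers, so that the differences of 0/1 matrices may have entries -1. *)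

definition zero_one_mat :: "nat \<Rightarrow> nat \<Rightarrow> int mat set" where
  "zero_one_mat nr nc = {M \<in> carrier_mat nr nc. elements_mat M \<subseteq> {0, 1}}"

definition bool_mult :: "int mat \<Rightarrow> int mat \<Rightarrow> int mat" (infixl "\<odot>" 70) where
  "U \<odot> V = mat (dim_row U) (dim_col V)
     (\<lambda>(i, j). of_bool (\<exists>l < dim_col U. U $$ (i, l) = 1 \<and> V $$ (l, j) = 1))"

definition entrywise_mult :: "int mat \<Rightarrow> int mat \<Rightarrow> int mat" (infixl "\<circ>\<^sub>m" 70) where
  "M \<circ>\<^sub>m N = mat (dim_row M) (dim_col M) (\<lambda>(i, j). M $$ (i, j) * N $$ (i, j))"

definition norm0 :: "int mat \<Rightarrow> nat" where
  "norm0 M = card {(i, j). i < dim_row M \<and> j < dim_col M \<and> M $$ (i, j) \<noteq> 0}"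

definition bitstrings :: "nat \<Rightarrow> bool list set" where
  "bitstrings m = {x. length x = m}"

(* horner_sum of_bool 2 is the binary value (least significant bit first); it maps
   bitstrings m bijectively onto the row and column indices {0..<2 ^ m}. *)

definition mat_fun :: "int mat \<Rightarrow> bool list \<Rightarrow> bool list \<Rightarrow> int" where
  "mat_fun W x y = W $$ (horner_sum of_bool 2 x, horner_sum of_bool 2 y)"

(* The rectangles are given as a family S i \<times> T i for i < r, so they may overlap,
   coincide or be empty. *)

definition rect_cover :: "nat \<Rightarrow> (bool list \<Rightarrow> bool list \<Rightarrow> int) \<Rightarrow> nat \<Rightarrow> bool" where
  "rect_cover m f r \<longleftrightarrow> (\<exists>S T.
     (\<forall>i<r. S i \<subseteq> bitstrings m \<and> T i \<subseteq> bitstrings m) \<and>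
     (\<forall>x \<in> bitstrings m. \<forall>y \<in> bitstrings m. f x y = 1 \<longrightarrow> (\<exists>i<r. (x, y) \<in> S i \<times> T i)) \<and>
     (\<forall>x \<in> bitstrings m. \<forall>y \<in> bitstrings m. f x y = 0 \<longrightarrow> (\<forall>i<r. (x, y) \<notin> S i \<times> T i)))"

(* A real number, not rounded up to an integer: 2 powr nondet_cc m f is the number of
   rectangles in a smallest nonempty covering family (thus nondet_cc m f = 0 for f = 0). *)

definition nondet_cc :: "nat \<Rightarrow> (bool list \<Rightarrow> bool list \<Rightarrow> int) \<Rightarrow> real" where
  "nondet_cc m f = (LEAST c. \<exists>r. real r = 2 powr c \<and> rect_cover m f r)"

end

theory Submission
  imports Defs
begin

text \<open>Let \<open>R\<close> be the number of rectangles \<open>S t \<times> T t\<close> in an optimal cover of \<open>W\<close>.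
  From an optimal pair \<open>U\<^sub>0\<close>, \<open>V\<^sub>0\<close> for the masked problem with inner dimension \<open>k\<close>, build a pair of
  inner dimension \<open>k * R\<close> by juxtaposing \<open>R\<close> copies, the \<open>t\<close>-th with the rows of \<open>U\<^sub>0\<close> restricted to
  \<open>S t\<close> and the columns of \<open>V\<^sub>0\<close> restricted to \<open>T t\<close>. Its Boolean product is
  \<open>W \<circ> (U\<^sub>0 \<cdot> V\<^sub>0)\<close>, so the unmasked minimum is at most \<open>OPT\<close>; masking with \<open>W\<close> cannot increase
  the error. This gives \<open>OPT + \<Delta>\<close>, and \<open>R \<ge> 1\<close>.\<close>

lemma zero_one_mat_iff:
  "M \<in> zero_one_mat nr nc \<longleftrightarrow>
     M \<in> carrier_mat nr nc \<and> (\<forall>i<nr. \<forall>j<nc. M $$ (i, j) = 0 \<or> M $$ (i, j) = 1)"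
proof (cases "M \<in> carrier_mat nr nc")
  case True
  then have "elements_mat M = (\<lambda>(i, j). M $$ (i, j)) ` ({..<nr} \<times> {..<nc})"
    by (auto simp: elements_mat_def)
  with True show ?thesis by (auto simp: zero_one_mat_def image_subset_iff)
qed (simp add: zero_one_mat_def)

text \<open>A bound that depends only on the dimensions makes the sets of norms under
  \<open>Min\<close> finite.\<close>

lemma norm0_le: "norm0 M \<le> dim_row M * dim_col M"
proof -
  have "norm0 M \<le> card ({..<dim_row M} \<times> {..<dim_col M})"
    unfolding norm0_def by (intro card_mono) auto
  then show ?thesis by (simp add: card_cartesian_product)
qed

lemma norm0_mono:
  assumes "dim_row M = dim_row M'" "dim_col M = dim_col M'"
    and "\<And>i j. \<lbrakk>i < dim_row M; j < dim_col M; M $$ (i, j) \<noteq> 0\<rbrakk> \<Longrightarrow> M' $$ (i, j) \<noteq> 0"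
  shows "norm0 M \<le> norm0 M'"
  unfolding norm0_def
proof (rule card_mono)
  show "finite {(i, j). i < dim_row M' \<and> j < dim_col M' \<and> M' $$ (i, j) \<noteq> 0}"
    by (rule finite_subset[of _ "{..<dim_row M'} \<times> {..<dim_col M'}"]) auto
qed (use assms in auto)

text \<open>With the next lemma, this makes \<open>map (bit i) [0..<m]\<close> the inverse of the
  index encoding in \<open>mat_fun\<close>, so covers can be moved between bit strings and matrix
  indices.\<close>

lemma map_bit_horner_sum:
  assumes "x \<in> bitstrings m"
  shows "map (bit (horner_sum of_bool 2 x :: nat)) [0..<m] = x"
  using assms by (intro nth_equalityI) (simp_all add: bitstrings_def bit_horner_sum_bit_iff)

lemma horner_sum_map_bit:
  assumes "i < 2 ^ m"
  shows "horner_sum of_bool 2 (map (bit i) [0..<m]) = (i :: nat)"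
  using assms by (simp add: horner_sum_bit_eq_take_bit take_bit_nat_eq_self)

text \<open>Each row is one rectangle: the singleton of its bit string times the columns where
  \<open>f\<close> is 1. So a nonempty covering family always exists.\<close>

lemma rect_cover_rows: "rect_cover m f (2 ^ m)"
proof -
  let ?S = "\<lambda>i::nat. {map (bit i) [0..<m]}"
  let ?T = "\<lambda>i::nat. {y \<in> bitstrings m. f (map (bit i) [0..<m]) y = 1}"
  have "\<exists>i<2 ^ m. (x, y) \<in> ?S i \<times> ?T i"
    if x: "x \<in> bitstrings m" and "y \<in> bitstrings m" "f x y = 1" for x y
  proof (intro exI conjI)
    show "(horner_sum of_bool 2 x :: nat) < 2 ^ m"
      using x horner_sum_of_bool_2_less[of x] by (simp add: bitstrings_def)
    show "(x, y) \<in> ?S (horner_sum of_bool 2 x) \<times> ?T (horner_sum of_bool 2 x)"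
      using that by (simp add: map_bit_horner_sum)
  qed
  moreover have "?S i \<subseteq> bitstrings m \<and> ?T i \<subseteq> bitstrings m" for i
    by (auto simp: bitstrings_def)
  ultimately show ?thesis
    unfolding rect_cover_def by (intro exI[of _ ?S] exI[of _ ?T]) auto
qed

text \<open>A \<open>LEAST\<close> over the reals need not be attained. Here it is, because the
  admissible exponents are logarithms of positive naturals: the least size \<open>r\<close> exists
  by well-ordering, and \<open>log 2\<close> is monotone.\<close>

lemma nondet_cc_attained:
  obtains r where "real r = 2 powr nondet_cc m f" "rect_cover m f r" "r > 0"
proof -
  define r where "r = (LEAST r. r > 0 \<and> rect_cover m f r)"
  have "r > 0 \<and> rect_cover m f r"
    unfolding r_def
    by (rule LeastI[where P = "\<lambda>r. r > 0 \<and> rect_cover m f r" and k = "2 ^ m"])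
      (simp add: rect_cover_rows)
  then have r: "r > 0" "rect_cover m f r" by auto
  have "nondet_cc m f = log 2 (real r)"
    unfolding nondet_cc_def
  proof (rule Least_equality)
    show "\<exists>s. real s = 2 powr log 2 (real r) \<and> rect_cover m f s"
      using r by auto
    fix c assume "\<exists>s. real s = 2 powr c \<and> rect_cover m f s"
    then obtain s where s: "real s = 2 powr c" "rect_cover m f s" by blast
    \<comment> \<open>Powers of 2 are positive, so the family with no rectangles never competes in
      the minimum.\<close>
    then have "s > 0" by (metis of_nat_0_less_iff powr_gt_zero zero_neq_numeral)
    then have "r \<le> s" unfolding r_def using s by (simp add: Least_le)
    then have "log 2 (real r) \<le> log 2 (real s)" using r by simp
    also have "\<dots> = c" using s by simp
    finally show "log 2 (real r) \<le> c" .
  qed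
  then show thesis using that r by simp
qed

text \<open>The rectangles are pulled back along the bit expansion of an index. A cover only
  constrains the values 0 and 1, so equality with \<open>of_bool\<close> relies on \<open>W\<close>
  being a 0/1 matrix.\<close>

lemma rect_cover_mat_fun:
  assumes "rect_cover m (mat_fun W) r" and W: "W \<in> zero_one_mat (2 ^ m) (2 ^ m)"
  obtains S T :: "nat \<Rightarrow> nat set" where
    "\<And>i j. \<lbrakk>i < 2 ^ m; j < 2 ^ m\<rbrakk> \<Longrightarrow> W $$ (i, j) = of_bool (\<exists>t<r. i \<in> S t \<and> j \<in> T t)"
proof -
  from assms(1) obtain S T where
    one: "\<forall>x \<in> bitstrings m. \<forall>y \<in> bitstrings m. mat_fun W x y = 1 \<longrightarrow> (\<exists>i<r. (x, y) \<in> S i \<times> T i)" and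
    zero: "\<forall>x \<in> bitstrings m. \<forall>y \<in> bitstrings m. mat_fun W x y = 0 \<longrightarrow> (\<forall>i<r. (x, y) \<notin> S i \<times> T i)"
    unfolding rect_cover_def by blast
  have mat_fun_eq: "mat_fun W x y = of_bool (\<exists>t<r. x \<in> S t \<and> y \<in> T t)"
    if xy: "x \<in> bitstrings m" "y \<in> bitstrings m" and "mat_fun W x y = 0 \<or> mat_fun W x y = 1" for x y
    using that(3)
  proof
    assume f: "mat_fun W x y = 0"
    then have "\<not> (\<exists>t<r. x \<in> S t \<and> y \<in> T t)" using zero xy by blast
    with f show ?thesis by simp
  next
    assume f: "mat_fun W x y = 1"
    then have "\<exists>t<r. x \<in> S t \<and> y \<in> T t" using one xy by blast
    with f show ?thesis by simp
  qed
  show thesis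
  proof (rule that)
    let ?b = "\<lambda>i::nat. map (bit i) [0..<m]"
    fix i j :: nat assume ij: "i < 2 ^ m" "j < 2 ^ m"
    have b: "?b i \<in> bitstrings m" "?b j \<in> bitstrings m" by (auto simp: bitstrings_def)
    have "mat_fun W (?b i) (?b j) = W $$ (i, j)"
      using ij by (simp only: mat_fun_def horner_sum_map_bit)
    moreover have "W $$ (i, j) = 0 \<or> W $$ (i, j) = 1"
      using W ij by (simp add: zero_one_mat_iff)
    ultimately have "W $$ (i, j) = of_bool (\<exists>t<r. ?b i \<in> S t \<and> ?b j \<in> T t)"
      using mat_fun_eq[OF b] by simp
    then show "W $$ (i, j) = of_bool (\<exists>t<r. i \<in> {i. ?b i \<in> S t} \<and> j \<in> {j. ?b j \<in> T t})"
      by simp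
  qed
qed

lemma masked_bool_mult_factorization:
  assumes U: "U \<in> zero_one_mat n k" and V: "V \<in> zero_one_mat k n"
    and W: "W \<in> carrier_mat n n"
    and cover: "\<And>i j. \<lbrakk>i < n; j < n\<rbrakk> \<Longrightarrow> W $$ (i, j) = of_bool (\<exists>t<r. i \<in> S t \<and> j \<in> T t)"
    and k': "k * r \<le> k'"
  obtains U' V' where "U' \<in> zero_one_mat n k'" "V' \<in> zero_one_mat k' n"
    "U' \<odot> V' = W \<circ>\<^sub>m (U \<odot> V)"
proof -
  \<comment> \<open>Inner index \<open>l\<close> stands for position \<open>l mod k\<close> in copy
    \<open>l div k\<close>. Indices from \<open>k * r\<close> up to \<open>k'\<close> are padded
    with zeros.\<close>
  define U' where "U' = mat n k' (\<lambda>(i, l).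
    of_bool (l < k * r \<and> i \<in> S (l div k) \<and> U $$ (i, l mod k) = 1) :: int)"
  define V' where "V' = mat k' n (\<lambda>(l, j).
    of_bool (l < k * r \<and> j \<in> T (l div k) \<and> V $$ (l mod k, j) = 1) :: int)"
  have dims: "dim_row U = n" "dim_col U = k" "dim_row V = k" "dim_col V = n"
    using U V by (auto simp: zero_one_mat_iff)
  \<comment> \<open>Membership in the rectangle depends only on the copy, and the entries of
    \<open>U\<close> and \<open>V\<close> only on the position within it. Hence the existential over
    \<open>l\<close> splits into two independent ones.\<close>
  have product: "(\<exists>l<k'. U' $$ (i, l) = 1 \<and> V' $$ (l, j) = 1) \<longleftrightarrow>
      (\<exists>t<r. i \<in> S t \<and> j \<in> T t) \<and> (\<exists>l<k. U $$ (i, l) = 1 \<and> V $$ (l, j) = 1)"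
    (is "?L \<longleftrightarrow> ?R") if ij: "i < n" "j < n" for i j
  proof
    assume ?L
    then obtain l where "l < k * r" "i \<in> S (l div k)" "j \<in> T (l div k)"
      "U $$ (i, l mod k) = 1" "V $$ (l mod k, j) = 1"
      using ij by (auto simp: U'_def V'_def)
    moreover from \<open>l < k * r\<close> have "l div k < r"
      by (intro less_mult_imp_div_less) (simp add: mult.commute)
    moreover from \<open>l < k * r\<close> have "l mod k < k"
      by (cases "k = 0") auto
    ultimately show ?R by blast
  next
    assume ?R
    then obtain t l where tl: "t < r" "i \<in> S t" "j \<in> T t" "l < k"
      "U $$ (i, l) = 1" "V $$ (l, j) = 1" by blast
    \<comment> \<open>Block \<open>t\<close> ends before \<open>Suc t * k\<close>, which is at most
      \<open>k * r\<close> since \<open>t < r\<close>.\<close>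
    have "t * k + l < Suc t * k" using tl by simp
    also have "\<dots> \<le> k * r" using tl by (subst mult.commute) (intro mult_le_mono2, simp)
    finally have "t * k + l < k * r" .
    moreover have "(t * k + l) div k = t" "(t * k + l) mod k = l" using tl by auto
    ultimately show ?L
      using tl ij k' by (intro exI[of _ "t * k + l"]) (simp add: U'_def V'_def)
  qed
  have "U' \<odot> V' = W \<circ>\<^sub>m (U \<odot> V)"
  proof (rule eq_matI)
    show "dim_row (U' \<odot> V') = dim_row (W \<circ>\<^sub>m (U \<odot> V))"
      "dim_col (U' \<odot> V') = dim_col (W \<circ>\<^sub>m (U \<odot> V))"
      using W by (auto simp: bool_mult_def entrywise_mult_def U'_def V'_def)
    fix i j assume "i < dim_row (W \<circ>\<^sub>m (U \<odot> V))" "j < dim_col (W \<circ>\<^sub>m (U \<odot> V))"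
    then have ij: "i < n" "j < n" using W by (auto simp: entrywise_mult_def)
    have "(U' \<odot> V') $$ (i, j) = of_bool (\<exists>l<k'. U' $$ (i, l) = 1 \<and> V' $$ (l, j) = 1)"
      using ij by (simp add: bool_mult_def U'_def V'_def)
    also have "\<dots> = W $$ (i, j) * (U \<odot> V) $$ (i, j)"
      unfolding product[OF ij] using ij dims by (simp add: bool_mult_def cover of_bool_conj)
    also have "\<dots> = (W \<circ>\<^sub>m (U \<odot> V)) $$ (i, j)"
      using ij W by (simp add: entrywise_mult_def)
    finally show "(U' \<odot> V') $$ (i, j) = (W \<circ>\<^sub>m (U \<odot> V)) $$ (i, j)" .
  qed
  moreover have "U' \<in> zero_one_mat n k'" "V' \<in> zero_one_mat k' n"
    by (auto simp: zero_one_mat_iff U'_def V'_def)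
  ultimately show thesis using that by blast
qed

theorem theorem4:
  fixes n m k k' :: nat and A W U V :: "int mat" and \<Delta> N OPT :: real
  assumes "n = 2 ^ m"
    and "A \<in> zero_one_mat n n" and "W \<in> zero_one_mat n n"
    and "N = nondet_cc m (mat_fun W)"
    and "k \<ge> 1" and "real k' \<ge> real k * 2 powr N"
    and "U \<in> zero_one_mat n k'" and "V \<in> zero_one_mat k' n"
    and "\<Delta> \<ge> 0"
    and "real (norm0 (A \<circ>\<^sub>m W - U \<odot> V))
           \<le> real (Min {norm0 (A \<circ>\<^sub>m W - U' \<odot> V') | U' V'.
                          U' \<in> zero_one_mat n k' \<and> V' \<in> zero_one_mat k' n}) + \<Delta>"
    and "OPT = real (Min {norm0 (W \<circ>\<^sub>m (A - U' \<odot> V')) | U' V'.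
                            U' \<in> zero_one_mat n k \<and> V' \<in> zero_one_mat k n})"
  shows "real (norm0 (W \<circ>\<^sub>m (A - U \<odot> V))) \<le> 2 powr N * OPT + \<Delta>"
proof -
  have A: "A \<in> carrier_mat n n" and W: "W \<in> carrier_mat n n"
    using assms(2,3) by (auto simp: zero_one_mat_iff)
  have UV: "X \<odot> Y \<in> carrier_mat n n"
    if "X \<in> zero_one_mat n q" "Y \<in> zero_one_mat q n" for X Y q
    using that by (auto simp: bool_mult_def zero_one_mat_iff)
  obtain r where r: "real r = 2 powr N" "rect_cover m (mat_fun W) r" "r > 0"
    using nondet_cc_attained assms(4) by metis
  obtain S T where cover:
    "\<And>i j. \<lbrakk>i < n; j < n\<rbrakk> \<Longrightarrow> W $$ (i, j) = of_bool (\<exists>t<r. i \<in> S t \<and> j \<in> T t)"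
    using rect_cover_mat_fun[OF r(2)] assms(1,3) by metis
  have "real (k * r) \<le> real k'" using assms(6) r(1) by simp
  then have k': "k * r \<le> k'" by (simp only: of_nat_le_iff)

  let ?E = "{norm0 (W \<circ>\<^sub>m (A - U' \<odot> V')) | U' V'. U' \<in> zero_one_mat n k \<and> V' \<in> zero_one_mat k n}"
  let ?F = "{norm0 (A \<circ>\<^sub>m W - U' \<odot> V') | U' V'. U' \<in> zero_one_mat n k' \<and> V' \<in> zero_one_mat k' n}"
  \<comment> \<open>\<open>Min\<close> is meaningful only on a finite nonempty set. The entrywise
    product takes its dimensions from \<open>W\<close>, and the zero matrices witness
    nonemptiness.\<close>
  have "?E \<subseteq> {..n * n}"
    using norm0_le[of "W \<circ>\<^sub>m M" for M] W by (auto simp: entrywise_mult_def)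
  then have "finite ?E" by (rule finite_subset) simp
  moreover have "0\<^sub>m n k \<in> zero_one_mat n k" "0\<^sub>m k n \<in> zero_one_mat k n"
    by (auto simp: zero_one_mat_iff)
  then have "?E \<noteq> {}" by blast
  ultimately have "Min ?E \<in> ?E" by (rule Min_in)
  then obtain U0 V0 where UV0: "U0 \<in> zero_one_mat n k" "V0 \<in> zero_one_mat k n"
    "OPT = real (norm0 (W \<circ>\<^sub>m (A - U0 \<odot> V0)))"
    using assms(11) by auto
  obtain U1 V1 where UV1: "U1 \<in> zero_one_mat n k'" "V1 \<in> zero_one_mat k' n"
    "U1 \<odot> V1 = W \<circ>\<^sub>m (U0 \<odot> V0)"
    using masked_bool_mult_factorization[OF UV0(1,2) W cover k'] by blast
  \<comment> \<open>Masking distributes over the integer difference, so the unmasked error of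
    \<open>U1\<close>, \<open>V1\<close> is exactly the optimal masked error.\<close>
  have "A \<circ>\<^sub>m W - U1 \<odot> V1 = W \<circ>\<^sub>m (A - U0 \<odot> V0)"
    unfolding UV1(3) using A W UV[OF UV0(1,2)]
    by (intro eq_matI) (auto simp: entrywise_mult_def algebra_simps)
  then have "norm0 (W \<circ>\<^sub>m (A - U0 \<odot> V0)) \<in> ?F" using UV1(1,2) by force
  moreover have "norm0 (A \<circ>\<^sub>m W - X \<odot> Y) \<le> n * n"
    if "X \<in> zero_one_mat n k'" "Y \<in> zero_one_mat k' n" for X Y
    using UV[OF that] norm0_le[of "A \<circ>\<^sub>m W - X \<odot> Y"] by simp
  then have "?F \<subseteq> {..n * n}" by auto
  then have "finite ?F" by (rule finite_subset) simp
  ultimately have "real (Min ?F) \<le> OPT" unfolding UV0(3) by (simp only: of_nat_le_iff Min_le)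

  have "norm0 (W \<circ>\<^sub>m (A - U \<odot> V)) \<le> norm0 (A \<circ>\<^sub>m W - U \<odot> V)"
  proof (rule norm0_mono)
    fix i j assume "i < dim_row (W \<circ>\<^sub>m (A - U \<odot> V))" "j < dim_col (W \<circ>\<^sub>m (A - U \<odot> V))"
      and nz: "(W \<circ>\<^sub>m (A - U \<odot> V)) $$ (i, j) \<noteq> 0"
    then have ij: "i < n" "j < n" using W by (auto simp: entrywise_mult_def)
    \<comment> \<open>A nonzero masked entry forces the mask to be 1 there, and then the masked and
      unmasked errors have the same entry.\<close>
    with nz assms(3) have "W $$ (i, j) = 1"
      using W by (auto simp: entrywise_mult_def zero_one_mat_iff)
    with nz show "(A \<circ>\<^sub>m W - U \<odot> V) $$ (i, j) \<noteq> 0"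
      using ij A W UV[OF assms(7,8)] by (auto simp: entrywise_mult_def)
  qed (use W UV[OF assms(7,8)] in \<open>auto simp: entrywise_mult_def\<close>)
  then have "real (norm0 (W \<circ>\<^sub>m (A - U \<odot> V))) \<le> OPT + \<Delta>"
    using assms(10) \<open>real (Min ?F) \<le> OPT\<close> by linarith
  also have "1 * OPT \<le> 2 powr N * OPT"
    using r UV0(3) by (intro mult_right_mono) auto
  then have "OPT + \<Delta> \<le> 2 powr N * OPT + \<Delta>" by simp
  finally show ?thesis .
qed

end
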